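(* For every integer $n\ge 1$, $$R_{\rho_2(n)}=R_n+R_{n-1}\qquad\text{and}\qquad R_{T(n)}=R_n,$$ where $T(n):=\lfloor n\phi+2/\phi\rfloor$.
   Context: $\phi=(1+\sqrt5)/2$. $F_n$ is the $n$th Fibonacci number ($F_1=F_2=1$, $F_{n+1}=F_n+F_{n-1}$). For an integer $n\ge0$, $R_n$ is the number of ways of writing $n$ as a sum of distinct Fibonacci numbers, i.e. the number of finite subsets $S\subset\{2,3,4,\dots\}$ with $\sum_{i\in S}F_i=n$ (so $R_0=1$, $R_1=1$). Let $\rho(n):=\lfloor n\phi+1/\phi\rfloor$ and $\rho_2(n):=\rho(\rho(n))=\lfloor n\phi^2+1/\phi\rfloor$. *)

theory Defs
  imports Complex_Main "HOL-Number_Theory.Fib"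
begin

definition phi :: real where
  "phi = (1 + sqrt 5) / 2"

text \<open>Indices start at 2, so that \<open>fib 1 = fib 2 = 1\<close> is available as a summand only once.
  The set counted is finite (lemma \<open>finite_fib_reps\<close>), so \<^const>\<open>card\<close> does not degenerate.\<close>

definition fib_reps :: "nat \<Rightarrow> nat set set" where
  "fib_reps n = {S. finite S \<and> S \<subseteq> {2..} \<and> (\<Sum>i\<in>S. fib i) = n}"

definition R :: "nat \<Rightarrow> nat" where
  "R n = card (fib_reps n)"

text \<open>The arguments of the floor functions below are nonnegative, so \<^const>\<open>nat\<close> truncates nothing.\<close>

definition rho :: "nat \<Rightarrow> nat" where
  "rho n = nat \<lfloor>real n * phi + 1 / phi\<rfloor>"

definition rho2 :: "nat \<Rightarrow> nat" where
  "rho2 n = rho (rho n)"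

definition T :: "nat \<Rightarrow> nat" where
  "T n = nat \<lfloor>real n * phi + 2 / phi\<rfloor>"

lemma fib_ge_pred: "i \<le> fib i + 1"
proof (induction i rule: fib.induct)
  case (3 n)
  show ?case
  proof (cases "n = 0")
    case False
    then have "fib n \<ge> 1" using fib_neq_0_nat[of n] by linarith
    then show ?thesis using 3 by simp
  qed simp
qed auto

lemma finite_fib_reps: "finite (fib_reps n)"
proof (rule finite_subset)
  show "fib_reps n \<subseteq> Pow {..n + 1}"
  proof
    fix S assume S: "S \<in> fib_reps n"
    have "i \<le> n + 1" if "i \<in> S" for i
    proof -
      have "fib i \<le> (\<Sum>i\<in>S. fib i)"
        using S that by (intro member_le_sum) (auto simp: fib_reps_def)
      then show ?thesis using S fib_ge_pred[of i] by (simp add: fib_reps_def)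
    qed
    then show "S \<in> Pow {..n + 1}" by auto
  qed
qed simp

lemma R_0: "R 0 = 1"
proof -
  have "S = {}" if "S \<in> fib_reps 0" for S
  proof -
    have "\<forall>i\<in>S. fib i = 0" "S \<subseteq> {2..}" using that by (auto simp: fib_reps_def)
    then have "i \<notin> S" for i using fib_neq_0_nat[of i] by (cases "i \<in> S") auto
    then show ?thesis by blast
  qed
  moreover have "{} \<in> fib_reps 0" by (simp add: fib_reps_def)
  ultimately have "fib_reps 0 = {{}}" by blast
  then show ?thesis by (simp add: R_def)
qed

lemma phi_gt_1: "phi > 1"
  by (simp add: phi_def)

lemma phi_square: "phi\<^sup>2 = phi + 1"
  by (simp add: phi_def power2_eq_square field_simps)

lemma inverse_phi: "1 / phi = phi - 1"
  using phi_square phi_gt_1 by (simp add: field_simps power2_eq_square)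

lemma phi_irrational: "phi \<notin> \<rat>"
proof
  assume "phi \<in> \<rat>"
  then have "2 * phi - 1 \<in> \<rat>" by (intro Rats_diff Rats_mult) auto
  then have "sqrt 5 \<in> \<rat>" by (simp add: phi_def add_divide_distrib)
  then obtain a b :: nat where ab: "b \<noteq> 0" "sqrt 5 = real a / real b" "coprime a b"
    by (smt (verit) Rats_abs_nat_div_natE real_sqrt_ge_zero)
  have "5 = (real a / real b)\<^sup>2" using ab(2) by (metis real_sqrt_pow2 zero_le_numeral)
  then have "real (5 * b\<^sup>2) = real (a\<^sup>2)" using ab(1) by (simp add: field_simps)
  then have eq: "5 * b\<^sup>2 = a\<^sup>2" by (simp only: of_nat_eq_iff)
  then have "b dvd a" by (metis dvd_triv_right pow_divides_pow_iff zero_less_numeral)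
  then have "b = 1" using ab(3) by (metis coprime_absorb_right nat_dvd_1_iff_1)
  with eq have "a\<^sup>2 = 5" by simp
  then have "a\<^sup>2 < 3\<^sup>2" "2\<^sup>2 < a\<^sup>2" by simp_all
  then have "a < 3" "2 < a" using power_less_imp_less_base by blast+
  then show False by simp
qed

lemma rho2_eq_floor: "int (rho2 n) = \<lfloor>real n * phi\<^sup>2 + 1 / phi\<rfloor>"
proof -
  define m where "m = \<lfloor>real n * phi + 1 / phi\<rfloor>"
  define f where "f = real n * phi + 1 / phi - of_int m"
  have f: "0 \<le> f" "f < 1" unfolding f_def m_def by linarith+
  have "f \<noteq> 0"
  proof
    assume "f = 0"
    then have "phi = (of_int m + 1) / (real n + 1)"
      by (simp add: f_def inverse_phi field_simps)
    also have "\<dots> \<in> \<rat>" by (intro Rats_divide Rats_add) auto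
    finally show False using phi_irrational by simp
  qed
  with f have f0: "f > 0" by simp
  have "m \<ge> 0" using phi_gt_1 by (simp add: m_def)
  then have rho: "real (rho n) = of_int m" by (simp add: rho_def m_def)
  have e1: "real n * phi\<^sup>2 + 1 / phi = of_int (int n + m) + f"
    by (simp add: f_def phi_square algebra_simps)
  have np: "real n * phi = of_int m + 1 + f - phi"
    by (simp add: f_def inverse_phi)
  have "of_int m = (real n + 1) * phi - 1 - f" using np by (simp add: algebra_simps)
  then have "of_int m * phi + 1 / phi = ((real n + 1) * phi - 1 - f) * phi + (phi - 1)"
    by (simp only: inverse_phi)
  also have "\<dots> = (real n + 1) * phi\<^sup>2 - phi - f * phi + (phi - 1)"
    by (simp add: algebra_simps power2_eq_square)
  also have "\<dots> = of_int (int n + m) + (1 - f * (phi - 1))"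
    using np by (simp add: phi_square algebra_simps)
  finally have e2: "of_int m * phi + 1 / phi = of_int (int n + m) + (1 - f * (phi - 1))" .
  have "phi < 2" by (simp add: phi_def real_less_lsqrt)
  then have "0 < f * (phi - 1)" "f * (phi - 1) < 1"
    using f0 f phi_gt_1 mult_strict_mono[of f 1 "phi - 1" 1] by auto
  then have "\<lfloor>of_int m * phi + 1 / phi\<rfloor> = int n + m"
    unfolding e2 by linarith
  then have "int (rho2 n) = int n + m"
    using \<open>m \<ge> 0\<close> by (simp add: rho2_def rho_def[of "rho n"] rho)
  also have "\<dots> = \<lfloor>real n * phi\<^sup>2 + 1 / phi\<rfloor>"
    unfolding e1 using f by linarith
  finally show ?thesis .
qed

end

theory Submission
  imports Defs
begin

text \<open>
  Raising every index of a representation of \<open>n\<close> by one always yields a representation of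
  \<open>rho n\<close>, whatever the representation was. Hence the representations of \<open>n\<close> correspond to the
  representations of \<open>rho n\<close> that avoid the index 2, and a number outside the range of \<open>rho\<close> has
  no representation avoiding 2. Deleting the index 2 then expresses \<open>R (N + 1)\<close> through the
  preimages of \<open>N + 1\<close> and \<open>N\<close> under \<open>rho\<close>, and both identities reduce to the gap structure of the
  range of \<open>rho\<close>: gaps are 1 or 2, the gap following a number \<open>rho (rho j)\<close> is 2, no two consecutive
  gaps are both 1, and \<open>T n = rho (n + 1) - 1\<close>.
\<close>

section \<open>Gaps and iterates of \<open>rho\<close>\<close>

lemma phi_bounds: "3 / 2 < phi" "phi < 2"
proof -
  have "2 < sqrt 5" by (rule real_less_rsqrt) simp
  moreover have "sqrt 5 < 3" by (rule real_less_lsqrt) simp_all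
  ultimately show "3 / 2 < phi" "phi < 2" by (auto simp: phi_def)
qed

text \<open>As \<open>1 / phi = phi - 1\<close>, this is the floor of \<open>(n + 1) * phi\<close>
  less 1; gaps of \<open>rho\<close> become differences of floors of consecutive multiples of
  \<open>phi\<close>.\<close>

lemma of_int_rho: "int (rho n) = \<lfloor>real n * phi + phi\<rfloor> - 1"
proof -
  have "\<lfloor>real n * phi + (phi - 1)\<rfloor> \<ge> 0"
    using phi_gt_1 by simp
  then show ?thesis
    unfolding rho_def inverse_phi
    by (simp add: floor_diff_of_int [of "real n * phi + phi" 1, simplified] add_diff_eq)
qed

lemma rho_0: "rho 0 = 0"
proof -
  have "\<lfloor>phi\<rfloor> = 1" using phi_bounds by linarith
  then show ?thesis using of_int_rho[of 0] by simp
qed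

lemma rho_Suc: "rho (Suc n) = rho n + 1 \<or> rho (Suc n) = rho n + 2"
  using of_int_rho[of n] of_int_rho[of "Suc n"] phi_bounds
  by (simp add: algebra_simps) linarith

text \<open>Follows from \<open>2 * phi > 3\<close>; it excludes two consecutive gaps of 1.\<close>

lemma rho_Suc_Suc: "rho n + 3 \<le> rho (Suc (Suc n))"
  using of_int_rho[of n] of_int_rho[of "Suc (Suc n)"] phi_bounds
  by (simp add: algebra_simps) linarith

lemma strict_mono_rho: "strict_mono rho"
  unfolding strict_mono_Suc_iff
proof
  show "rho n < rho (Suc n)" for n using rho_Suc[of n] by linarith
qed

lemma rho_rho: "rho (rho n) = rho n + n"
proof -
  have "int (rho2 n) = \<lfloor>real n * phi + phi + of_int (int n - 1)\<rfloor>"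
    unfolding rho2_eq_floor inverse_phi phi_square by (simp add: algebra_simps)
  also have "\<dots> = int (rho n + n)"
    unfolding floor_add_int [symmetric] using of_int_rho[of n] by simp
  finally show ?thesis by (simp add: rho2_def)
qed

text \<open>With \<open>f\<close> the fractional part of \<open>(n + 1) * phi\<close>, the identity
  \<open>phi\<^sup>2 = phi + 1\<close> leaves the remainder \<open>(1 - f) * (phi - 1)\<close>,
  which lies in [0, 1). Combined with \<open>rho_rho\<close>, the gap after
  \<open>rho (rho n)\<close> is 2.\<close>

lemma rho_Suc_rho: "rho (Suc (rho n)) = rho n + n + 2"
proof -
  define f where "f = real n * phi + phi - 1 - real (rho n)"
  have f: "0 \<le> f" "f < 1"
    using of_int_rho[of n] unfolding f_def by linarith+
  have "real (rho n) * phi = (real n * phi + phi - 1 - f) * phi"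
    by (simp add: f_def)
  also have "\<dots> = (real n + 1) * phi\<^sup>2 - (1 + f) * phi"
    by (simp add: algebra_simps power2_eq_square)
  also have "\<dots> = real n * phi + real n + 1 - f * phi"
    by (simp add: phi_square algebra_simps)
  finally have "real (Suc (rho n)) * phi + phi = real (rho n + n + 3) + (1 - f) * (phi - 1)"
    by (simp add: f_def algebra_simps)
  moreover have "0 \<le> (1 - f) * (phi - 1)" using f phi_bounds by simp
  moreover have "(1 - f) * (phi - 1) < 1"
    using f phi_bounds mult_left_le_one_le[of "phi - 1" "1 - f"] by linarith
  ultimately have "\<lfloor>real (Suc (rho n)) * phi + phi\<rfloor> = int (rho n + n + 3)"
    by linarith
  then show ?thesis using of_int_rho[of "Suc (rho n)"] by simp
qed

lemma T_eq: "T n + 1 = rho (Suc n)"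
proof -
  have "real n * phi + 2 / phi = (real (Suc n) * phi + phi) - of_int 2"
    using inverse_phi by (simp add: algebra_simps divide_inverse)
  then have "\<lfloor>real n * phi + 2 / phi\<rfloor> = int (rho (Suc n)) - 1"
    unfolding of_int_rho by (simp only: floor_diff_of_int)
  moreover have "0 < rho (Suc n)" using rho_Suc[of n] by linarith
  ultimately show ?thesis by (simp add: T_def)
qed

section \<open>Shifting the indices of a representation\<close>

lemma Suc_image_pred:
  assumes "S \<subseteq> {2..}" "(2::nat) \<notin> S"
  shows "Suc ` {i. 2 \<le> i \<and> Suc i \<in> S} = S"
proof
  show "S \<subseteq> Suc ` {i. 2 \<le> i \<and> Suc i \<in> S}"
  proof
    fix x assume x: "x \<in> S"
    with assms have "x \<ge> 3" by (cases "x = 2") force+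
    with x show "x \<in> Suc ` {i. 2 \<le> i \<and> Suc i \<in> S}"
      by (intro image_eqI[of _ _ "x - 1"]) auto
  qed
qed auto

text \<open>Induction on a bound for the indices. Lower the indices other than 2 by one and let
  \<open>s\<close> be the resulting sum. By the induction hypothesis those indices sum to
  \<open>rho s\<close>, and by the Fibonacci recurrence their shift sums to
  \<open>rho s + s = rho (rho s)\<close>. Index 2 adds 1 to the sum and \<open>fib 3 = 2\<close> to
  the shifted sum, which matches \<open>rho_Suc_rho\<close>.\<close>

lemma sum_fib_Suc_eq_rho:
  assumes "finite S" "S \<subseteq> {2..}"
  shows "(\<Sum>i\<in>S. fib (Suc i)) = rho (\<Sum>i\<in>S. fib i)"
proof -
  have "S \<subseteq> {2..<m} \<Longrightarrow> ?thesis" for m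
    using assms
  proof (induction m arbitrary: S)
    case 0
    then show ?case by (simp add: rho_0)
  next
    case (Suc m)
    define S' where "S' = {i. 2 \<le> i \<and> Suc i \<in> S - {2}}"
    have image: "Suc ` S' = S - {2}"
      unfolding S'_def using Suc.prems by (intro Suc_image_pred) auto
    then have fin: "finite S'"
      using Suc.prems by (metis finite_Diff finite_imageD inj_Suc)
    have "S' \<subseteq> {2..<m}" using Suc.prems by (auto simp: S'_def)
    then have IH: "(\<Sum>i\<in>S'. fib (Suc i)) = rho (\<Sum>i\<in>S'. fib i)"
      using fin by (intro Suc.IH) auto
    have reindex: "sum g (S - {2}) = (\<Sum>i\<in>S'. g (Suc i))" for g :: "nat \<Rightarrow> nat"
      unfolding image [symmetric] by (simp add: sum.reindex)
    have "(\<Sum>i\<in>S - {2}. fib (Suc i)) = rho (\<Sum>i\<in>S'. fib i) + (\<Sum>i\<in>S'. fib i)"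
      unfolding reindex by (simp add: sum.distrib flip: IH)
    moreover have "(\<Sum>i\<in>S - {2}. fib i) = rho (\<Sum>i\<in>S'. fib i)"
      unfolding reindex by (rule IH)
    ultimately show ?case
      using Suc.prems(2)
      by (cases "2 \<in> S")
        (simp_all add: sum.remove[of S 2] rho_rho rho_Suc_rho numeral_2_eq_2)
  qed
  moreover obtain m where "S \<subseteq> {..<m}"
    using assms(1) finite_nat_set_iff_bounded by auto
  then have "S \<subseteq> {2..<m}" using assms(2) by auto
  ultimately show ?thesis by blast
qed

definition fib_reps_ge3 :: "nat \<Rightarrow> nat set set" where
  "fib_reps_ge3 n = {S \<in> fib_reps n. 2 \<notin> S}"

text \<open>The union has at most one member, \<open>rho\<close> being injective; this form also
  covers an \<open>N\<close> outside the range, where it is empty.\<close>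

lemma fib_reps_ge3_eq: "fib_reps_ge3 N = (\<Union>n\<in>{n. rho n = N}. image Suc ` fib_reps n)"
proof (intro equalityI subsetI)
  fix S assume S: "S \<in> fib_reps_ge3 N"
  define S' where "S' = {i. 2 \<le> i \<and> Suc i \<in> S}"
  have image: "Suc ` S' = S"
    unfolding S'_def using S
    by (intro Suc_image_pred) (auto simp: fib_reps_ge3_def fib_reps_def)
  have "finite S"
    using S by (simp add: fib_reps_ge3_def fib_reps_def)
  then have S': "finite S'" "S' \<subseteq> {2..}"
    using finite_imageD[of Suc S'] image by (auto simp: S'_def)
  have "rho (\<Sum>i\<in>S'. fib i) = (\<Sum>i\<in>S'. fib (Suc i))"
    using sum_fib_Suc_eq_rho[OF S'] by (rule sym)
  also have "\<dots> = (\<Sum>i\<in>Suc ` S'. fib i)"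
    by (simp add: sum.reindex)
  also have "\<dots> = N"
    unfolding image using S by (simp add: fib_reps_ge3_def fib_reps_def)
  finally have "rho (\<Sum>i\<in>S'. fib i) = N" .
  moreover have "S' \<in> fib_reps (\<Sum>i\<in>S'. fib i)"
    using S' by (simp add: fib_reps_def)
  ultimately show "S \<in> (\<Union>n\<in>{n. rho n = N}. image Suc ` fib_reps n)"
    using image by blast
next
  fix S assume "S \<in> (\<Union>n\<in>{n. rho n = N}. image Suc ` fib_reps n)"
  then obtain S' where S': "finite S'" "S' \<subseteq> {2..}" "rho (\<Sum>i\<in>S'. fib i) = N" "S = Suc ` S'"
    by (auto simp: fib_reps_def)
  then have "(\<Sum>i\<in>S. fib i) = N"
    using sum_fib_Suc_eq_rho[of S'] by (simp add: sum.reindex)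
  with S' show "S \<in> fib_reps_ge3 N"
    by (force simp: fib_reps_ge3_def fib_reps_def)
qed

lemma card_fib_reps_ge3_rho: "card (fib_reps_ge3 (rho n)) = R n"
proof -
  have "{m. rho m = rho n} = {n}"
    using strict_mono_rho by (auto simp: strict_mono_eq)
  then have "fib_reps_ge3 (rho n) = image Suc ` fib_reps n"
    by (simp add: fib_reps_ge3_eq)
  then show ?thesis
    by (simp add: R_def card_image inj_on_image)
qed

lemma card_fib_reps_ge3_gap:
  assumes "rho n < N" "N < rho (Suc n)"
  shows "card (fib_reps_ge3 N) = 0"
proof -
  have "rho m \<noteq> N" for m
    using assms strict_mono_less[OF strict_mono_rho] by (metis not_less_eq less_asym less_antisym)
  then show ?thesis by (simp add: fib_reps_ge3_eq)
qed

lemma R_Suc: "R (Suc N) = card (fib_reps_ge3 (Suc N)) + card (fib_reps_ge3 N)"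
proof -
  have "fib_reps (Suc N) - fib_reps_ge3 (Suc N) = insert 2 ` fib_reps_ge3 N"
  proof (intro equalityI subsetI)
    fix S assume "S \<in> fib_reps (Suc N) - fib_reps_ge3 (Suc N)"
    then have S: "finite S" "S \<subseteq> {2..}" "2 \<in> S" "(\<Sum>i\<in>S. fib i) = Suc N"
      by (auto simp: fib_reps_ge3_def fib_reps_def)
    then have "S - {2} \<in> fib_reps_ge3 N"
      by (auto simp: fib_reps_ge3_def fib_reps_def sum.remove[of S 2] numeral_2_eq_2)
    moreover have "S = insert 2 (S - {2})" using S by auto
    ultimately show "S \<in> insert 2 ` fib_reps_ge3 N" by blast
  next
    fix S assume "S \<in> insert 2 ` fib_reps_ge3 N"
    then show "S \<in> fib_reps (Suc N) - fib_reps_ge3 (Suc N)"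
      by (auto simp: fib_reps_ge3_def fib_reps_def numeral_2_eq_2)
  qed
  moreover have "inj_on (insert 2) (fib_reps_ge3 N)"
    by (simp add: inj_on_def fib_reps_ge3_def insert_ident)
  ultimately have "card (fib_reps (Suc N) - fib_reps_ge3 (Suc N)) = card (fib_reps_ge3 N)"
    by (simp add: card_image)
  moreover have "fib_reps_ge3 (Suc N) \<subseteq> fib_reps (Suc N)"
    by (auto simp: fib_reps_ge3_def)
  ultimately show ?thesis
    using finite_fib_reps[of "Suc N"] unfolding R_def
    by (metis card_Diff_subset card_mono finite_subset le_add_diff_inverse)
qed

section \<open>The two identities\<close>

lemma R_rho2_Suc: "R (rho2 (Suc m)) = R (Suc m) + R m"
proof -
  obtain k where k: "rho (Suc m) = Suc k" "k = rho m \<or> k = Suc (rho m)"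
    using rho_Suc[of m] by auto
  have "rho (Suc k) = Suc k + Suc m"
    using rho_rho[of "Suc m"] k by simp
  then obtain l where l: "rho (Suc k) = Suc l" "l = k + Suc m" by auto
  have "R (rho2 (Suc m)) = card (fib_reps_ge3 (rho (Suc k))) + card (fib_reps_ge3 l)"
    using R_Suc[of l] k l by (simp add: rho2_def)
  also have "\<dots> = R (rho (Suc m)) + card (fib_reps_ge3 l)"
    using k by (simp only: card_fib_reps_ge3_rho)
  also have "\<dots> = R (Suc m) + card (fib_reps_ge3 k) + card (fib_reps_ge3 l)"
    using R_Suc[of k] k card_fib_reps_ge3_rho[of "Suc m"] by simp
  finally have "R (rho2 (Suc m)) = R (Suc m) + card (fib_reps_ge3 k) + card (fib_reps_ge3 l)" .
  \<comment> \<open>Exactly one of \<open>k\<close> and \<open>l\<close> is in the range of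
    \<open>rho\<close>. If the gap after \<open>rho m\<close> is 1, then \<open>k = rho m\<close>
    and \<open>l = rho k + 1\<close> falls in a gap of 2. Otherwise \<open>k\<close> falls in a gap
    and \<open>l = rho k\<close>, where \<open>R k = R m\<close>.\<close>
  moreover have "card (fib_reps_ge3 k) + card (fib_reps_ge3 l) = R m"
  proof (cases "k = rho m")
    case True
    then have "card (fib_reps_ge3 l) = 0"
      using rho_rho[of m] l by (intro card_fib_reps_ge3_gap[of k]) auto
    with True show ?thesis by (simp add: card_fib_reps_ge3_rho)
  next
    case False
    then have "k = Suc (rho m)" using k by simp
    moreover from this have gap: "card (fib_reps_ge3 k) = 0"
      using k by (intro card_fib_reps_ge3_gap[of m]) auto
    ultimately have "R k = R m"
      using R_Suc[of "rho m"] by (simp add: card_fib_reps_ge3_rho)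
    moreover have "rho k = l"
      using \<open>k = Suc (rho m)\<close> l rho_Suc_rho[of m] by simp
    ultimately show ?thesis
      using gap card_fib_reps_ge3_rho[of k] by simp
  qed
  ultimately show ?thesis by simp
qed

text \<open>One of \<open>T n\<close> and \<open>T n - 1\<close> equals \<open>rho n\<close> and the
  other is outside the range of \<open>rho\<close>, so \<open>R_Suc\<close> leaves a single
  term.\<close>

lemma R_T_Suc: "R (T (Suc m)) = R (Suc m)"
proof (cases "rho (Suc (Suc m)) = rho (Suc m) + 1")
  case True
  then have "T (Suc m) = rho (Suc m)" using T_eq[of "Suc m"] by simp
  \<comment> \<open>The gap after \<open>rho (Suc m)\<close> is 1, so the gap before it is 2 and
    contains \<open>k\<close>.\<close>
  moreover obtain k where k: "rho (Suc m) = Suc k" "rho m < k"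
    using rho_Suc_Suc[of m] True by (cases "rho (Suc m)") auto
  then have "card (fib_reps_ge3 k) = 0"
    by (intro card_fib_reps_ge3_gap[of m]) auto
  ultimately show ?thesis
    using R_Suc[of k] k card_fib_reps_ge3_rho[of "Suc m"] by simp
next
  case False
  then have gap: "rho (Suc (Suc m)) = rho (Suc m) + 2"
    using rho_Suc[of "Suc m"] by simp
  then have "T (Suc m) = Suc (rho (Suc m))" using T_eq[of "Suc m"] by simp
  moreover have "card (fib_reps_ge3 (Suc (rho (Suc m)))) = 0"
    using gap by (intro card_fib_reps_ge3_gap[of "Suc m"]) auto
  ultimately show ?thesis
    using R_Suc[of "rho (Suc m)"] by (simp add: card_fib_reps_ge3_rho)
qed

theorem theorem4p3:
  fixes n :: nat
  assumes "n \<ge> 1"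
  shows "R (rho2 n) = R n + R (n - 1) \<and> R (T n) = R n"
proof -
  obtain m where "n = Suc m" using assms by (cases n) auto
  then show ?thesis by (simp add: R_rho2_Suc R_T_Suc)
qed

end
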